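(* In the queueing network, let $V>0$ and $H_m(0)=0$ for all $m$. Suppose that on every slot the auxiliary variables $\gamma_m(t)$ are chosen to maximize $V\phi_m(\gamma)-H_m(t)\gamma$ over $0\le\gamma\le A_m^{max}$; that the flow control decisions are $x_m(t)=A_m(t)$ if $Q_{n_m}^{(c_m)}(t)\le H_m(t)$ and $x_m(t)=0$ otherwise; that $I(t)\in\mathcal{I}_{S(t)}$ is chosen in an arbitrary manner; and that the transmission variables are given, with respect to the chosen $I(t)$, by $$\mu_{ij}^{(c)}(t)=\begin{cases}C_{ij}(I(t),S(t))&\text{if }c=\hat c_{ij}^*(t)\text{ and }\hat W_{ij}^{(c)}(t)\ge0,\\0&\text{otherwise.}\end{cases}$$ Then for all nodes $n$, all commodities $c$ and all $t\ge0$, $$Q_n^{(c)}(t)\le Q^{max}=V\nu^{max}+A^{max}+\beta^{max},$$ provided that this inequality holds at $t=0$ for all $n,c$.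
   Context: Network model. Time is slotted, $t\in\{0,1,2,\ldots\}$. There are $N$ nodes and $M$ sessions; session $m$ has a source node $n_m$ and a destination node $c_m$. $A_m(t)$ is the exogenous data arriving for session $m$ on slot $t$, $0\le A_m(t)\le A_m^{max}<\infty$, an arbitrary sequence. Flow control decisions $x_m(t)$ satisfy $0\le x_m(t)\le A_m(t)$. Data destined for node $c$ is called commodity $c$; $\mathcal{M}_n^{(c)}$ is the set of sessions with source $n$ and destination $c$. $S(t)$ is an arbitrary topology state; a resource allocation $I(t)$ is chosen in a set $\mathcal{I}_{S(t)}$, and gives link rates $C_{ij}(I(t),S(t))$, $i\ne j$, with $0\le C_{ij}(\cdot,\cdot)\le\mu_{ij}^{max}<\infty$ (put $C_{ii}=0$). Transmission variables $\mu_{ij}^{(c)}(t)$ are always required to satisfy $\mu_{ij}^{(c)}(t)\ge0$, $\mu_{ii}^{(c)}(t)=\mu_{ij}^{(i)}(t)=0$, and $\sum_{c}\mu_{ij}^{(c)}(t)\le C_{ij}(I(t),S(t))$ (so any rule for choosing them is understood with $\mu_{ij}^{(i)}(t)=0$). Queues: $Q_n^{(c)}(t)\ge0$, $Q_n^{(n)}(t)=0$ for all $t$, and for $n\ne c$, $Q_n^{(c)}(t+1)=\max[Q_n^{(c)}(t)-\sum_j\mu_{nj}^{(c)}(t),0]+\sum_i\mu_{in}^{(c)}(t)+\sum_{m\in\mathcal{M}_n^{(c)}}x_m(t)$. Virtual queues: $H_m(t+1)=H_m(t)+\gamma_m(t)-x_m(t)$. Each $\phi_m$ is a continuous, concave,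 non-decreasing function on $[0,A_m^{max}]$ with right derivative $\nu_m$ at $0$, $0\le\nu_m<\infty$. Constants: $\beta_n$ is the largest total amount of any single commodity that can enter node $n$ in one slot, counting both exogenous arrivals $x_m$ and transmissions from other nodes (finite); $\nu^{max}=\max_m\nu_m$, $A^{max}=\max_mA_m^{max}$, $\beta^{max}=\max_n\beta_n$, and $Q^{max}=V\nu^{max}+A^{max}+\beta^{max}$. Modified weights: $\theta_i^{(c)}\ge0$ are arbitrary fixed constants, $W_{ij}^{(c)}(t)=Q_i^{(c)}(t)-Q_j^{(c)}(t)$, and $$\hat W_{ij}^{(c)}(t)=\begin{cases}W_{ij}^{(c)}(t)+\theta_i^{(c)}-\theta_j^{(c)}&\text{if }Q_j^{(c)}(t)\le Q^{max}-\beta_j,\\-1&\text{otherwise.}\end{cases}$$ $\hat c_{ij}^*(t)$ is a commodity $c\in\{1,\ldots,N\}$ maximizing $\hat W_{ij}^{(c)}(t)$ (ties broken arbitrarily). *)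

theory Defs
  imports "HOL-Analysis.Analysis"
begin

text \<open>
  Nodes and commodities share the finite type \<open>'n\<close> (commodity \<open>c\<close> is the data destined for
  node \<open>c\<close>); sessions range over the finite type \<open>'m\<close>, topology states over \<open>'s\<close> and resource
  allocations over \<open>'i\<close>.
\<close>

definition sessions :: "('m \<Rightarrow> 'n) \<Rightarrow> ('m \<Rightarrow> 'n) \<Rightarrow> 'n \<Rightarrow> 'n \<Rightarrow> 'm set" where
  "sessions src dst n c = {m. src m = n \<and> dst m = c}"

text \<open>
  Here \<open>R i j\<close> is the rate of link \<open>(i, j)\<close> on the slot considered and \<open>mu i j c\<close> the amount of
  commodity \<open>c\<close> offered to it.
\<close>

definition feasible_transmission ::
    "('n::finite \<Rightarrow> 'n \<Rightarrow> real) \<Rightarrow> ('n \<Rightarrow> 'n \<Rightarrow> 'n \<Rightarrow> real) \<Rightarrow> bool" where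
  "feasible_transmission R mu \<longleftrightarrow>
     (\<forall>i j c. 0 \<le> mu i j c) \<and>
     (\<forall>i c. mu i i c = 0) \<and>
     (\<forall>i j. mu i j i = 0) \<and>
     (\<forall>i j. (\<Sum>c\<in>UNIV. mu i j c) \<le> R i j)"

text \<open>
  All amounts of a single commodity that can enter node \<open>n\<close> in one slot, over every commodity
  (including \<open>n\<close> itself), topology state, allowed allocation, feasible transmission and
  admitted exogenous data. \<open>C i j I s\<close> is the rate of link \<open>(i, j)\<close> under allocation \<open>I\<close> in
  state \<open>s\<close>.
\<close>

definition entry_amounts ::
    "('m::finite \<Rightarrow> 'n::finite) \<Rightarrow> ('m \<Rightarrow> 'n) \<Rightarrow> ('m \<Rightarrow> real) \<Rightarrow> ('s \<Rightarrow> 'i set) \<Rightarrow>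
     ('n \<Rightarrow> 'n \<Rightarrow> 'i \<Rightarrow> 's \<Rightarrow> real) \<Rightarrow> 'n \<Rightarrow> real set" where
  "entry_amounts src dst Amax Alloc C n =
     {(\<Sum>m\<in>sessions src dst n c. x m) + (\<Sum>i\<in>UNIV - {n}. mu i n c) | c x mu I s.
        I \<in> Alloc s \<and> (\<forall>m. 0 \<le> x m \<and> x m \<le> Amax m) \<and>
        feasible_transmission (\<lambda>i j. C i j I s) mu}"

definition max_entry ::
    "('m::finite \<Rightarrow> 'n::finite) \<Rightarrow> ('m \<Rightarrow> 'n) \<Rightarrow> ('m \<Rightarrow> real) \<Rightarrow> ('s \<Rightarrow> 'i set) \<Rightarrow>
     ('n \<Rightarrow> 'n \<Rightarrow> 'i \<Rightarrow> 's \<Rightarrow> real) \<Rightarrow> 'n \<Rightarrow> real" where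
  "max_entry src dst Amax Alloc C n = Sup (entry_amounts src dst Amax Alloc C n)"

text \<open>The argument \<open>q\<close> is the backlog on a single slot: \<open>q i c\<close> is the queue of commodity \<open>c\<close> at \<open>i\<close>.\<close>

definition modified_weight ::
    "('n \<Rightarrow> 'n \<Rightarrow> real) \<Rightarrow> ('n \<Rightarrow> real) \<Rightarrow> real \<Rightarrow> ('n \<Rightarrow> 'n \<Rightarrow> real) \<Rightarrow> 'n \<Rightarrow> 'n \<Rightarrow> 'n \<Rightarrow> real" where
  "modified_weight \<theta> \<beta> Qmax q i j c =
     (if q j c \<le> Qmax - \<beta> j then (q i c - q j c) + \<theta> i c - \<theta> j c else - 1)"

end

theory Submission
  imports Defs
begin

text \<open>
  For \<open>H > V \<nu>\<close> the tangent bound \<open>\<phi> g \<le> \<phi> 0 + \<nu> g\<close> makes \<open>\<gamma> = 0\<close> the only maximizer of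
  \<open>V \<phi> \<gamma> - H \<gamma>\<close>, so a virtual queue grows only from below \<open>V \<nu>\<close> and never exceeds \<open>V \<nu> + Amax\<close>.
  A backlog \<open>Q n c\<close> of at most \<open>Qmax - \<beta> n\<close> cannot exceed \<open>Qmax\<close> one slot later. A larger
  one exceeds every virtual queue, so flow control admits nothing, and it makes the modified
  weights of commodity \<open>c\<close> on all links into \<open>n\<close> equal to \<open>- 1\<close>, so nothing is transmitted to
  \<open>n\<close> either.
\<close>

text \<open>By concavity the slope of the chord from \<open>a\<close> to \<open>y\<close> does not
  increase with \<open>y\<close>. Its limit \<open>d\<close> as \<open>y\<close> tends to
  \<open>a\<close> is therefore at least the slope of the chord to \<open>g\<close>.\<close>

lemma concave_on_below_tangent_at_left_end:
  fixes f :: "real \<Rightarrow> real"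
  assumes conc: "concave_on {a..b} f"
    and deriv: "(f has_real_derivative d) (at a within {a..b})"
    and g: "g \<in> {a..b}"
  shows "f g \<le> f a + d * (g - a)"
proof (cases "g = a")
  case False
  with g have ag: "a < g" "g \<le> b" by auto
  have "((\<lambda>y. (f y - f a) / (y - a)) \<longlongrightarrow> d) (at a within {a..b})"
    using deriv by (simp add: has_field_derivative_iff)
  moreover have "eventually (\<lambda>y. (f g - f a) / (g - a) \<le> (f y - f a) / (y - a))
      (at a within {a..b})"
    unfolding eventually_at
  proof (intro exI conjI ballI impI)
    \<comment> \<open>The radius \<open>g - a\<close> confines \<open>y\<close> to the open interval
      between \<open>a\<close> and \<open>g\<close>.\<close>
    show "g - a > 0" using ag by simp
    fix y assume "y \<in> {a..b}" and y: "y \<noteq> a \<and> dist y a < g - a"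
    then have y: "a < y" "y < g" by (auto simp: dist_real_def)
    \<comment> \<open>\<open>t\<close> is the weight of \<open>g\<close> when \<open>y\<close> is
      written as a convex combination of \<open>a\<close> and \<open>g\<close>.\<close>
    define t where "t = (y - a) / (g - a)"
    have t: "0 < t" "t \<le> 1" using y ag by (auto simp: t_def)
    have "t * (g - a) = y - a" using ag by (simp add: t_def)
    then have y_eq: "y = (1 - t) * a + t * g" by (simp add: algebra_simps)
    have "(1 - t) * f a + t * f g \<le> f ((1 - t) * a + t * g)"
      using concave_onD[OF conc, of t a g] t ag by simp
    then have "t * (f g - f a) \<le> f y - f a"
      by (simp add: y_eq algebra_simps)
    then show "(f g - f a) / (g - a) \<le> (f y - f a) / (y - a)"
      using y ag by (simp add: t_def field_simps)
  qed
  moreover have "at a within {a..b} \<noteq> bot"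
    using ag by (simp add: trivial_limit_within)
  ultimately have "(f g - f a) / (g - a) \<le> d"
    by (rule tendsto_lowerbound)
  then show ?thesis using ag by (simp add: field_simps)
qed simp

text \<open>\<open>max_entry\<close> is a real supremum, so it dominates the individual amounts only
  once the set is known to be bounded.\<close>

lemma bdd_above_entry_amounts:
  fixes src dst :: "'m::finite \<Rightarrow> 'n::finite"
  assumes rates: "\<And>i a s. a \<in> Alloc s \<Longrightarrow> i \<noteq> n \<Longrightarrow> C i n a s \<le> \<mu>max i n"
  shows "bdd_above (entry_amounts src dst Amax Alloc C n)"
proof (rule bdd_aboveI)
  fix e assume "e \<in> entry_amounts src dst Amax Alloc C n"
  then obtain c x mu a s where e: "e = (\<Sum>m\<in>sessions src dst n c. x m) + (\<Sum>i\<in>UNIV - {n}. mu i n c)"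
    and a: "a \<in> Alloc s" and x: "\<And>m. 0 \<le> x m \<and> x m \<le> Amax m"
    and mu: "feasible_transmission (\<lambda>i j. C i j a s) mu"
    unfolding entry_amounts_def by blast
  \<comment> \<open>Extending the sum to all sessions makes the bound independent of the commodity
    \<open>c\<close>.\<close>
  have "(\<Sum>m\<in>sessions src dst n c. x m) \<le> (\<Sum>m\<in>UNIV. x m)"
    using x by (intro sum_mono2) auto
  also have "\<dots> \<le> (\<Sum>m\<in>UNIV. Amax m)" using x by (intro sum_mono) auto
  finally have sx: "(\<Sum>m\<in>sessions src dst n c. x m) \<le> (\<Sum>m\<in>UNIV. Amax m)" .
  have "(\<Sum>i\<in>UNIV - {n}. mu i n c) \<le> (\<Sum>i\<in>UNIV - {n}. \<mu>max i n)"
  proof (rule sum_mono)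
    fix i assume i: "i \<in> UNIV - {n}"
    have "mu i n c \<le> (\<Sum>c\<in>UNIV. mu i n c)"
      using mu by (intro member_le_sum) (auto simp: feasible_transmission_def)
    also have "\<dots> \<le> C i n a s" using mu by (auto simp: feasible_transmission_def)
    also have "\<dots> \<le> \<mu>max i n" using rates[OF a] i by auto
    finally show "mu i n c \<le> \<mu>max i n" .
  qed
  with sx show "e \<le> (\<Sum>m\<in>UNIV. Amax m) + (\<Sum>i\<in>UNIV - {n}. \<mu>max i n)"
    unfolding e by simp
qed

lemma virtual_queue_bound:
  fixes H \<gamma> x :: "nat \<Rightarrow> real"
  assumes conc: "concave_on {0..a} \<phi>"
    and deriv: "(\<phi> has_real_derivative \<nu>) (at 0 within {0..a})"
    and "0 \<le> \<nu>" "V > 0" "0 \<le> a"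
    and H_init: "H 0 = 0"
    and H_step: "\<And>t. H (Suc t) = H t + \<gamma> t - x t"
    and x: "\<And>t. 0 \<le> x t"
    and opt: "\<And>t. is_arg_max (\<lambda>g. V * \<phi> g - H t * g) (\<lambda>g. 0 \<le> g \<and> g \<le> a) (\<gamma> t)"
  shows "H t \<le> V * \<nu> + a"
proof (induction t)
  case 0
  show ?case using assms by simp
next
  case (Suc t)
  \<comment> \<open>\<open>le\<close> compares the maximizer with the admissible choice 0.\<close>
  have g: "0 \<le> \<gamma> t" "\<gamma> t \<le> a"
    and le: "V * \<phi> 0 \<le> V * \<phi> (\<gamma> t) - H t * \<gamma> t"
    using opt[of t] \<open>0 \<le> a\<close> by (auto simp: is_arg_max_def not_less dest: spec[of _ 0])
  show ?case
  proof (cases "H t \<le> V * \<nu>")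
    case True
    then show ?thesis using H_step[of t] g x[of t] by simp
  next
    case False
    have "V * \<phi> (\<gamma> t) \<le> V * (\<phi> 0 + \<nu> * \<gamma> t)"
      using concave_on_below_tangent_at_left_end[OF conc deriv, of "\<gamma> t"] g \<open>V > 0\<close> by simp
    \<comment> \<open>The tangent bound cancels \<open>V * \<phi> 0\<close>. Since
      \<open>H t - V * \<nu>\<close> is positive in this case, only \<open>\<gamma> t = 0\<close>
      remains, and the virtual queue cannot grow.\<close>
    with le have "(H t - V * \<nu>) * \<gamma> t \<le> 0"
      by (simp add: algebra_simps)
    with False g have "\<gamma> t = 0"
      by (simp add: mult_le_0_iff)
    then show ?thesis using H_step[of t] x[of t] Suc.IH by simp
  qed
qed

theorem lemma3:
  fixes src dst :: "'m::finite \<Rightarrow> 'n::finite"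
    and A x \<gamma> H :: "'m \<Rightarrow> nat \<Rightarrow> real"
    and Amax \<nu> :: "'m \<Rightarrow> real"
    and \<phi> :: "'m \<Rightarrow> real \<Rightarrow> real"
    and S :: "nat \<Rightarrow> 's"
    and Alloc :: "'s \<Rightarrow> 'i set"
    and I :: "nat \<Rightarrow> 'i"
    and C :: "'n \<Rightarrow> 'n \<Rightarrow> 'i \<Rightarrow> 's \<Rightarrow> real"
    and \<mu>max :: "'n \<Rightarrow> 'n \<Rightarrow> real"
    and \<mu> :: "'n \<Rightarrow> 'n \<Rightarrow> 'n \<Rightarrow> nat \<Rightarrow> real"
    and Q :: "'n \<Rightarrow> 'n \<Rightarrow> nat \<Rightarrow> real"
    and \<theta> :: "'n \<Rightarrow> 'n \<Rightarrow> real"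
    and chat :: "'n \<Rightarrow> 'n \<Rightarrow> nat \<Rightarrow> 'n"
    and \<beta> :: "'n \<Rightarrow> real"
    and V Qmax :: real
  assumes arrivals: "\<And>m t. 0 \<le> A m t \<and> A m t \<le> Amax m"
    and admission: "\<And>m t. 0 \<le> x m t \<and> x m t \<le> A m t"
    and rates: "\<And>i j a s. a \<in> Alloc s \<Longrightarrow> i \<noteq> j \<Longrightarrow> 0 \<le> C i j a s \<and> C i j a s \<le> \<mu>max i j"
    and rates_diag: "\<And>i a s. C i i a s = 0"
    and transmissions:
      "\<And>t. feasible_transmission (\<lambda>i j. C i j (I t) (S t)) (\<lambda>i j c. \<mu> i j c t)"
    and Q_nonneg: "\<And>n c t. 0 \<le> Q n c t"
    and Q_dest: "\<And>n t. Q n n t = 0"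
    and Q_step: "\<And>n c t. n \<noteq> c \<Longrightarrow>
      Q n c (Suc t) = max (Q n c t - (\<Sum>j\<in>UNIV. \<mu> n j c t)) 0
        + (\<Sum>i\<in>UNIV. \<mu> i n c t) + (\<Sum>m\<in>sessions src dst n c. x m t)"
    and H_init: "\<And>m. H m 0 = 0"
    and H_step: "\<And>m t. H m (Suc t) = H m t + \<gamma> m t - x m t"
    and utility: "\<And>m. continuous_on {0..Amax m} (\<phi> m)"
      "\<And>m. concave_on {0..Amax m} (\<phi> m)"
      "\<And>m. mono_on {0..Amax m} (\<phi> m)"
      "\<And>m. (\<phi> m has_real_derivative \<nu> m) (at 0 within {0..Amax m})"
      "\<And>m. 0 \<le> \<nu> m"
    and V_pos: "V > 0"
    and theta_nonneg: "\<And>i c. 0 \<le> \<theta> i c"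
    and beta: "\<beta> = max_entry src dst Amax Alloc C"
    and Qmax: "Qmax = V * Max (range \<nu>) + Max (range Amax) + Max (range \<beta>)"
    and auxiliary_rule:
      "\<And>m t. is_arg_max (\<lambda>g. V * \<phi> m g - H m t * g) (\<lambda>g. 0 \<le> g \<and> g \<le> Amax m) (\<gamma> m t)"
    and flow_rule:
      "\<And>m t. x m t = (if Q (src m) (dst m) t \<le> H m t then A m t else 0)"
    and allocation: "\<And>t. I t \<in> Alloc (S t)"
    and commodity_rule: "\<And>i j t. i \<noteq> j \<Longrightarrow>
      is_arg_max (modified_weight \<theta> \<beta> Qmax (\<lambda>k c. Q k c t) i j) (\<lambda>c. True) (chat i j t)"
    and transmission_rule: "\<And>i j c t. \<mu> i j c t =
      (if c = chat i j t \<and> modified_weight \<theta> \<beta> Qmax (\<lambda>k d. Q k d t) i j c \<ge> 0 \<and> c \<noteq> i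
       then C i j (I t) (S t) else 0)"
    and initial: "\<And>n c. Q n c 0 \<le> Qmax"
  shows "Q n c t \<le> Qmax"
proof -
  have H_bound: "H m t \<le> V * Max (range \<nu>) + Max (range Amax)" for m t
  proof -
    have "0 \<le> Amax m" using arrivals[of m 0] by linarith
    then have "H m t \<le> V * \<nu> m + Amax m"
      using virtual_queue_bound[where H = "H m" and \<gamma> = "\<gamma> m" and x = "x m",
          OF utility(2,4,5) V_pos _ H_init H_step _ auxiliary_rule] admission by blast
    moreover have "V * \<nu> m \<le> V * Max (range \<nu>)"
      using V_pos by (intro mult_left_mono) auto
    moreover have "Amax m \<le> Max (range Amax)" by simp
    ultimately show ?thesis by linarith
  qed
  have \<mu>_nonneg: "0 \<le> \<mu> i j c t" and \<mu>_self: "\<mu> i i c t = 0" for i j c t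
    using transmissions[of t] by (auto simp: feasible_transmission_def)
  have x_bounds: "0 \<le> x m t \<and> x m t \<le> Amax m" for m t
    using admission[of m t] arrivals[of m t] by auto
  \<comment> \<open>Removing the vanishing diagonal term matches the index set in
    \<open>entry_amounts\<close>.\<close>
  have into: "(\<Sum>i\<in>UNIV. \<mu> i n c t) = (\<Sum>i\<in>UNIV - {n}. \<mu> i n c t)" for n c t
    by (simp add: sum.remove[of UNIV n] \<mu>_self)
  have entry: "(\<Sum>m\<in>sessions src dst n c. x m t) + (\<Sum>i\<in>UNIV. \<mu> i n c t) \<le> \<beta> n" for n c t
    unfolding beta max_entry_def
  proof (rule cSup_upper)
    show "bdd_above (entry_amounts src dst Amax Alloc C n)"
      using rates by (intro bdd_above_entry_amounts[where \<mu>max = \<mu>max]) auto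
    show "(\<Sum>m\<in>sessions src dst n c. x m t) + (\<Sum>i\<in>UNIV. \<mu> i n c t)
        \<in> entry_amounts src dst Amax Alloc C n"
      unfolding entry_amounts_def mem_Collect_eq into
      using x_bounds transmissions allocation
      \<comment> \<open>The actual decisions of slot \<open>t\<close> witness membership.\<close>
      by (intro exI[of _ c] exI[of _ "\<lambda>m. x m t"] exI[of _ "\<lambda>i j c. \<mu> i j c t"]
          exI[of _ "I t"] exI[of _ "S t"]) simp
  qed
  show ?thesis
  proof (induction t arbitrary: n c)
    case 0
    show ?case by (rule initial)
  next
    case (Suc t)
    have \<beta>_le: "\<beta> n \<le> Max (range \<beta>)" by simp
    show ?case
    proof (cases "n = c")
      case True
      \<comment> \<open>Both backlogs are 0 here; the induction hypothesis serves only to give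
        \<open>0 \<le> Qmax\<close>.\<close>
      then show ?thesis
        using Q_dest[of c t] Q_dest[of c "Suc t"] Suc.IH[of c c] by simp
    next
      case False
      \<comment> \<open>Service never raises a nonnegative backlog, so the truncated difference in
        \<open>Q_step\<close> is at most \<open>Q n c t\<close>.\<close>
      have "0 \<le> (\<Sum>j\<in>UNIV. \<mu> n j c t)"
        by (intro sum_nonneg \<mu>_nonneg)
      then have step: "Q n c (Suc t) \<le> Q n c t + (\<Sum>i\<in>UNIV. \<mu> i n c t)
          + (\<Sum>m\<in>sessions src dst n c. x m t)"
        using Q_step[OF False, of t] Q_nonneg[of n c t] by linarith
      show ?thesis
      proof (cases "Q n c t \<le> Qmax - \<beta> n")
        case True
        then show ?thesis using step entry[where n = n and c = c and t = t] by linarith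
      next
        case full: False
        \<comment> \<open>The default weight \<open>- 1\<close> fails the test
          \<open>\<ge> 0\<close> in the transmission rule, for every sender
          \<open>i\<close>.\<close>
        then have "\<mu> i n c t = 0" for i
          using transmission_rule[of i n c t] by (simp add: modified_weight_def)
        moreover have "x m t = 0" if "m \<in> sessions src dst n c" for m
        proof -
          \<comment> \<open>\<open>Qmax - \<beta> n\<close> is at least the bound on
            \<open>H m t\<close>, because \<open>Qmax\<close> reserves the largest
            \<open>\<beta>\<close>. Strictness matters, since the flow rule still admits data on
            equality.\<close>
          have "H m t < Q n c t" using full H_bound[where m = m and t = t] \<beta>_le Qmax by linarith
          then show ?thesis using that flow_rule[of m t] by (simp add: sessions_def)
        qed
        ultimately show ?thesis using step Suc.IH[of n c] by simp
      qed
    qed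
  qed
qed

end
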